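(* Let $\widetilde{G}$ be a connected $U(\mathbb{Q})$-gain graph of order $n\geq 2$ with $p(\widetilde{G})=0$. Then $r(\widetilde{G})=n-2c(\widetilde{G})$ if and only if $\widetilde{G}$ is a $U(\mathbb{Q})$-gain cycle of Type 1.
   Context: All graphs are finite and simple (no loops or multiple edges). $\mathbb{Q}$ denotes the real quaternions (not the rationals), and $U(\mathbb{Q})=\{q\in\mathbb{Q}:|q|=1\}$. A $U(\mathbb{Q})$-gain graph $\widetilde{G}=(G,U(\mathbb{Q}),\varphi)$ consists of a simple graph $G$ with vertices $v_1,\dots,v_n$ (the underlying graph) and a map $\varphi$ assigning to each ordered pair $(v_i,v_j)$ of adjacent vertices a unit quaternion $\varphi_{v_iv_j}$ with $\varphi_{v_iv_j}=\varphi_{v_jv_i}^{-1}=\overline{\varphi_{v_jv_i}}$. Its adjacency matrix $A(\widetilde{G})=(h_{ij})$ is the $n\times n$ Hermitian quaternion matrix with $h_{ij}=\varphi_{v_iv_j}$ if $v_i,v_j$ are adjacent and $h_{ij}=0$ otherwise. The rank $r(\widetilde{G})$ is the row left rank of $A(\widetilde{G})$, i.e. the maximum number of rows that are left linearly independent over $\mathbb{Q}$. $p(\widetilde{G})$ is the number of pendant vertices (vertices of degree 1), and $c(\widetilde{G})=|E(\widetilde{G})|-|V(\widetilde{G})|+\omega(\widetilde{G})$ is the cyclomatic number, where $\omega(\widetilde{G})$ is the number of connected components. A $U(\mathbb{Q})$-gain cycle is a $U(\mathbb{Q})$-gain graph whose underlying graph is a cycle. A $U(\mathbb{Q})$-gain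 cycle $\widetilde{C}_m$ with vertices $u_1,\dots,u_m$ in cyclic order ($m\ge 3$) is of Type 1 if $m$ is even and $\varphi(\widetilde{C}_m):=\varphi_{u_1u_2}\varphi_{u_2u_3}\cdots\varphi_{u_{m-1}u_m}\varphi_{u_mu_1}=(-1)^{m/2}$ (this does not depend on the starting vertex or direction). *)

theory Defs
  imports "HOL-Analysis.Product_Vector" "Graph_Theory.Digraph_Component"
begin

section \<open>Real quaternions\<close>

datatype quaternion = Quaternion (qRe: real) (qIm1: real) (qIm2: real) (qIm3: real)

instantiation quaternion :: division_ring
begin

definition "0 = Quaternion 0 0 0 0"

definition "1 = Quaternion 1 0 0 0"

definition "p + q =
  Quaternion (qRe p + qRe q) (qIm1 p + qIm1 q) (qIm2 p + qIm2 q) (qIm3 p + qIm3 q)"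

definition "- q = Quaternion (- qRe q) (- qIm1 q) (- qIm2 q) (- qIm3 q)"

definition "p - q =
  Quaternion (qRe p - qRe q) (qIm1 p - qIm1 q) (qIm2 p - qIm2 q) (qIm3 p - qIm3 q)"

definition "p * q = Quaternion
  (qRe p * qRe q - qIm1 p * qIm1 q - qIm2 p * qIm2 q - qIm3 p * qIm3 q)
  (qRe p * qIm1 q + qIm1 p * qRe q + qIm2 p * qIm3 q - qIm3 p * qIm2 q)
  (qRe p * qIm2 q - qIm1 p * qIm3 q + qIm2 p * qRe q + qIm3 p * qIm1 q)
  (qRe p * qIm3 q + qIm1 p * qIm2 q - qIm2 p * qIm1 q + qIm3 p * qRe q)"

definition "inverse q =
  (let s = (qRe q)\<^sup>2 + (qIm1 q)\<^sup>2 + (qIm2 q)\<^sup>2 + (qIm3 q)\<^sup>2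
   in Quaternion (qRe q / s) (- qIm1 q / s) (- qIm2 q / s) (- qIm3 q / s))"

definition "p div q = p * inverse (q :: quaternion)"

lemmas quaternion_arith_defs = zero_quaternion_def one_quaternion_def plus_quaternion_def
  uminus_quaternion_def minus_quaternion_def times_quaternion_def

lemma quaternion_sum_squares_nonzero:
  assumes "q \<noteq> 0"
  shows "(qRe q)\<^sup>2 + (qIm1 q)\<^sup>2 + (qIm2 q)\<^sup>2 + (qIm3 q)\<^sup>2 \<noteq> 0"
  using assms
  by (cases q)
    (smt (verit) zero_quaternion_def quaternion.sel zero_le_power2 power_eq_0_iff)

instance
proof
  fix p q r :: quaternion
  show "p + q + r = p + (q + r)" "p + q = q + p" "0 + p = p" "- p + p = 0" "p - q = p + - q"
    by (cases p; cases q; cases r; simp add: quaternion_arith_defs)+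
  show "p * q * r = p * (q * r)" "(p + q) * r = p * r + q * r" "p * (q + r) = p * q + p * r"
    by (cases p; cases q; cases r; simp add: quaternion_arith_defs algebra_simps)+
  show "1 * p = p" "p * 1 = p"
    by (cases p; simp add: quaternion_arith_defs)+
  show "(0::quaternion) \<noteq> 1"
    by (simp add: quaternion_arith_defs)
  show "inverse (0::quaternion) = 0"
    by (simp add: quaternion_arith_defs inverse_quaternion_def)
  show "p div q = p * inverse q"
    by (simp add: divide_quaternion_def)
  assume "p \<noteq> 0"
  from quaternion_sum_squares_nonzero[OF this]
  show "inverse p * p = 1" "p * inverse p = 1"
    by (cases p; simp add: quaternion_arith_defs inverse_quaternion_def Let_def
        power2_eq_square add_divide_distrib[symmetric] diff_divide_distrib[symmetric] mult.commute)+
qed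

end

instantiation quaternion :: real_normed_div_algebra
begin

definition "r *\<^sub>R q = Quaternion (r * qRe q) (r * qIm1 q) (r * qIm2 q) (r * qIm3 q)"

definition "norm q = sqrt ((qRe q)\<^sup>2 + (qIm1 q)\<^sup>2 + (qIm2 q)\<^sup>2 + (qIm3 q)\<^sup>2)"

definition "sgn q = inverse (norm q) *\<^sub>R (q :: quaternion)"

definition "dist p q = norm (p - q :: quaternion)"

definition "uniformity =
  (INF e\<in>{0<..}. principal {(p :: quaternion, q). dist p q < e})"

definition "open U \<longleftrightarrow>
  (\<forall>p\<in>U. \<forall>\<^sub>F (p', q) in uniformity. p' = p \<longrightarrow> (q :: quaternion) \<in> U)"

lemma norm_quaternion_eq_norm_Pair:
  "norm q = norm ((qRe q, qIm1 q), (qIm2 q, qIm3 q))"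
  by (simp add: norm_quaternion_def norm_Pair)

instance
proof
  fix p q :: quaternion and a b :: real
  show "a *\<^sub>R (p + q) = a *\<^sub>R p + a *\<^sub>R q" "(a + b) *\<^sub>R p = a *\<^sub>R p + b *\<^sub>R p"
    "a *\<^sub>R b *\<^sub>R p = (a * b) *\<^sub>R p" "1 *\<^sub>R p = p"
    "a *\<^sub>R p * q = a *\<^sub>R (p * q)" "p * a *\<^sub>R q = a *\<^sub>R (p * q)"
    by (cases p; cases q; simp add: quaternion_arith_defs scaleR_quaternion_def algebra_simps)+
  show "dist p q = norm (p - q)" "sgn p = inverse (norm p) *\<^sub>R p"
    by (simp_all add: dist_quaternion_def sgn_quaternion_def)
  show "uniformity = (INF e\<in>{0<..}. principal {(p :: quaternion, q). dist p q < e})"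
    by (fact uniformity_quaternion_def)
  show "open U \<longleftrightarrow> (\<forall>p\<in>U. \<forall>\<^sub>F (p', q) in uniformity. p' = p \<longrightarrow> q \<in> U)"
    for U :: "quaternion set"
    by (fact open_quaternion_def)
  show "norm p = 0 \<longleftrightarrow> p = 0"
    by (cases p) (simp add: norm_quaternion_eq_norm_Pair zero_quaternion_def zero_prod_def)
  show "norm (p + q) \<le> norm p + norm q"
    using norm_triangle_ineq[of "((qRe p, qIm1 p), (qIm2 p, qIm3 p))"
        "((qRe q, qIm1 q), (qIm2 q, qIm3 q))"]
    by (simp add: norm_quaternion_eq_norm_Pair plus_quaternion_def)
  show "norm (a *\<^sub>R p) = \<bar>a\<bar> * norm p"
    using norm_scaleR[of a "((qRe p, qIm1 p), (qIm2 p, qIm3 p))"]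
    by (simp add: norm_quaternion_eq_norm_Pair scaleR_quaternion_def)
  show "norm (p * q) = norm p * norm q"
    by (cases p; cases q)
      (simp add: norm_quaternion_def times_quaternion_def real_sqrt_mult[symmetric]
        power2_eq_square algebra_simps)
qed

end

definition qcnj :: "quaternion \<Rightarrow> quaternion" where
  "qcnj q = Quaternion (qRe q) (- qIm1 q) (- qIm2 q) (- qIm3 q)"

lemma inverse_eq_qcnj_if_norm_1:
  fixes q :: quaternion
  assumes "norm q = 1"
  shows "inverse q = qcnj q"
  using assms by (simp add: norm_quaternion_def inverse_quaternion_def qcnj_def)


section \<open>Row left rank of quaternion matrices\<close>

text \<open>
  A square matrix with rows and columns indexed by a finite set \<open>V\<close> is a function
  of two indices, of which only the values on \<open>V\<close> matter.  Independence is that of the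
  family of rows with indices in \<open>S\<close>, so two equal rows with different indices are dependent.
\<close>

definition rows_left_independent ::
    "'a set \<Rightarrow> ('a \<Rightarrow> 'a \<Rightarrow> 'k::division_ring) \<Rightarrow> 'a set \<Rightarrow> bool" where
  "rows_left_independent V A S \<longleftrightarrow>
     (\<forall>c. (\<forall>j\<in>V. (\<Sum>i\<in>S. c i * A i j) = 0) \<longrightarrow> (\<forall>i\<in>S. c i = 0))"

definition row_left_rank :: "'a set \<Rightarrow> ('a \<Rightarrow> 'a \<Rightarrow> 'k::division_ring) \<Rightarrow> nat" where
  "row_left_rank V A = Max (card ` {S. S \<subseteq> V \<and> rows_left_independent V A S})"


section \<open>Gain graphs over the unit quaternions\<close>

text \<open>
  A finite simple graph is a \<^locale>\<open>pair_graph\<close>: a finite loop-free symmetric digraph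
  without parallel arcs, in which \<open>(u, v)\<close> and \<open>(v, u)\<close> together represent
  one undirected edge.  The arcs are exactly the ordered pairs of adjacent vertices; the gain
  map is constrained only on them.
\<close>

locale quaternion_gain_graph = pair_graph G
  for G :: "'a pair_pre_digraph" +
  fixes \<phi> :: "'a \<times> 'a \<Rightarrow> quaternion"
  assumes norm_gain: "(u, v) \<in> parcs G \<Longrightarrow> norm (\<phi> (u, v)) = 1"
    and gain_inverse: "(u, v) \<in> parcs G \<Longrightarrow> \<phi> (u, v) = inverse (\<phi> (v, u))"
begin

lemma gain_qcnj: "(u, v) \<in> parcs G \<Longrightarrow> \<phi> (u, v) = qcnj (\<phi> (v, u))"
  using gain_inverse inverse_eq_qcnj_if_norm_1 norm_gain arcs_symmetric by (metis with_proj_simps(3))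

end

definition gain_adjacency ::
    "'a pair_pre_digraph \<Rightarrow> ('a \<times> 'a \<Rightarrow> quaternion) \<Rightarrow> 'a \<Rightarrow> 'a \<Rightarrow> quaternion" where
  "gain_adjacency G \<phi> u v = (if (u, v) \<in> parcs G then \<phi> (u, v) else 0)"

definition gain_rank :: "'a pair_pre_digraph \<Rightarrow> ('a \<times> 'a \<Rightarrow> quaternion) \<Rightarrow> nat" where
  "gain_rank G \<phi> = row_left_rank (pverts G) (gain_adjacency G \<phi>)"

text \<open>In a symmetric digraph the out-degree of a vertex is its undirected degree.\<close>

definition num_pendant :: "'a pair_pre_digraph \<Rightarrow> nat" where
  "num_pendant G = card {v \<in> pverts G. out_degree (with_proj G) v = 1}"

definition undirected_edges :: "'a pair_pre_digraph \<Rightarrow> 'a set set" where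
  "undirected_edges G = {{u, v} | u v. (u, v) \<in> parcs G}"

text \<open>
  The strongly connected components of a symmetric digraph are its connected components.
  The cyclomatic number is taken in \<^typ>\<open>int\<close> to avoid truncated subtraction.
\<close>

definition cyclomatic_number :: "'a pair_pre_digraph \<Rightarrow> int" where
  "cyclomatic_number G =
     int (card (undirected_edges G)) - int (card (pverts G))
       + int (card (pre_digraph.sccs (with_proj G)))"

text \<open>
  For \<open>us = [u\<^sub>1, \<dots>, u\<^sub>m]\<close>, the list \<^term>\<open>zip us (rotate1 us)\<close> is
  \<open>[(u\<^sub>1, u\<^sub>2), \<dots>, (u\<^sub>m\<^sub>-\<^sub>1, u\<^sub>m), (u\<^sub>m, u\<^sub>1)]\<close>.
\<close>

definition cyclic_ordering :: "'a pair_pre_digraph \<Rightarrow> 'a list \<Rightarrow> bool" where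
  "cyclic_ordering G us \<longleftrightarrow>
     length us \<ge> 3 \<and> distinct us \<and> set us = pverts G \<and>
     parcs G = set (zip us (rotate1 us)) \<union> (set (zip us (rotate1 us)))\<inverse>"

definition cycle_gain :: "('a \<times> 'a \<Rightarrow> quaternion) \<Rightarrow> 'a list \<Rightarrow> quaternion" where
  "cycle_gain \<phi> us = prod_list (map \<phi> (zip us (rotate1 us)))"

definition type1_gain_cycle :: "'a pair_pre_digraph \<Rightarrow> ('a \<times> 'a \<Rightarrow> quaternion) \<Rightarrow> bool" where
  "type1_gain_cycle G \<phi> \<longleftrightarrow>
     (\<exists>us. cyclic_ordering G us \<and> even (length us) \<and>
           cycle_gain \<phi> us = (- 1) ^ (length us div 2))"

end

(*
  The rank is at least n - |Z| as soon as the only left kernel vector vanishing on Z is 0.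
  The kernel equation at v says that once x is known to vanish at all neighbours of v but one,
  it vanishes at the last one too.  Growing Z from an edge along a connected graph of minimum
  degree at least 2 therefore costs at most 2 + sum (deg v - 2) = 2c vertices.  If some vertex u
  of degree at least 3 lies on a cycle, process u only after everything reachable without u: by
  then both cycle neighbours of u are known, one choice is saved, and r > n - 2c.

  Otherwise any cycle (one exists by the longest path argument) consists of vertices of degree 2,
  so it is all of G and c = 1.  Along a cycle the kernel equation reads
  x(u_{i+2}) = - x(u_i) phi(u_i,u_{i+1}) phi(u_{i+1},u_{i+2}).  For even length, one turn multiplies
  x(u_0) by (-1)^(m/2) times the gain, so there are two independent solutions exactly for Type 1;
  for odd length x(u_0) determines x.
*)
theory Submission
  imports Defs
begin

section \<open>Rank and forcing sets\<close>

definition left_kernel :: "'a set \<Rightarrow> ('a \<Rightarrow> 'a \<Rightarrow> 'k::division_ring) \<Rightarrow> ('a \<Rightarrow> 'k) set" where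
  "left_kernel V A = {x. \<forall>j\<in>V. (\<Sum>i\<in>V. x i * A i j) = 0}"

text \<open>With \<open>K = V\<close> this says that a kernel vector is determined on
  \<open>V\<close> by its values on \<open>Z\<close>; sizes of such sets stand in for the dimension
  of the kernel.\<close>

definition forces :: "'a set \<Rightarrow> ('a \<Rightarrow> 'a \<Rightarrow> 'k::division_ring) \<Rightarrow> 'a set \<Rightarrow> 'a set \<Rightarrow> bool" where
  "forces V A Z K \<longleftrightarrow>
     (\<forall>x\<in>left_kernel V A. (\<forall>i\<in>Z. x i = 0) \<longrightarrow> (\<forall>i\<in>K. x i = 0))"

lemma forcesI:
  assumes "\<And>x i. x \<in> left_kernel V A \<Longrightarrow> (\<And>i. i \<in> Z \<Longrightarrow> x i = 0) \<Longrightarrow> i \<in> K \<Longrightarrow> x i = 0"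
  shows "forces V A Z K"
  unfolding forces_def
proof (intro ballI impI)
  fix x i assume x: "x \<in> left_kernel V A" "\<forall>i\<in>Z. x i = 0" and i: "i \<in> K"
  show "x i = 0" by (rule assms[OF x(1) bspec[OF x(2)] i])
qed

lemma forcesD:
  assumes "forces V A Z K" "x \<in> left_kernel V A" "\<And>i. i \<in> Z \<Longrightarrow> x i = 0" "i \<in> K"
  shows "x i = 0"
  using assms(1)[unfolded forces_def, rule_format, OF assms(2,3,4)] .

text \<open>Left relations among the rows outside \<open>Z\<close>, extended by zero, are the kernel
  vectors vanishing on \<open>Z\<close>.\<close>

lemma rows_left_independent_Diff_iff:
  assumes "finite V"
  shows "rows_left_independent V A (V - Z) \<longleftrightarrow> forces V A Z V"
    (is "?L \<longleftrightarrow> ?R")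
proof
  assume L: ?L
  show ?R
  proof (rule forcesI)
    fix x i assume x: "x \<in> left_kernel V A" "\<And>i. i \<in> Z \<Longrightarrow> x i = 0" and i: "i \<in> V"
    have "(\<Sum>i\<in>V - Z. x i * A i j) = (\<Sum>i\<in>V. x i * A i j)" for j
      using assms x(2) by (intro sum.mono_neutral_left) auto
    with x(1) have "\<forall>j\<in>V. (\<Sum>i\<in>V - Z. x i * A i j) = 0"
      by (simp add: left_kernel_def)
    with L have "\<forall>i\<in>V - Z. x i = 0"
      unfolding rows_left_independent_def by blast
    with x(2) i show "x i = 0" by blast
  qed
next
  assume R: ?R
  show ?L
    unfolding rows_left_independent_def
  proof (intro allI impI)
    fix c assume c: "\<forall>j\<in>V. (\<Sum>i\<in>V - Z. c i * A i j) = 0"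
    define x where "x i = (if i \<in> V - Z then c i else 0)" for i
    have "(\<Sum>i\<in>V. x i * A i j) = (\<Sum>i\<in>V - Z. c i * A i j)" for j
      using assms by (intro sum.mono_neutral_cong_right) (auto simp: x_def)
    with c have "x \<in> left_kernel V A" by (simp add: left_kernel_def)
    then have "x i = 0" if "i \<in> V" for i
      by (rule forcesD[OF R _ _ that]) (simp add: x_def)
    then show "\<forall>i\<in>V - Z. c i = 0" by (metis DiffD1 x_def)
  qed
qed

section \<open>Bounds on the rank\<close>

lemma card_le_row_left_rank:
  assumes "finite V" "S \<subseteq> V" "rows_left_independent V A S"
  shows "card S \<le> row_left_rank V A"
  unfolding row_left_rank_def using assms by (intro Max_ge) auto

lemma row_left_rank_leI:
  assumes "finite V" "\<And>S. S \<subseteq> V \<Longrightarrow> rows_left_independent V A S \<Longrightarrow> card S \<le> k"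
  shows "row_left_rank V A \<le> k"
proof -
  have "rows_left_independent V A {}" by (simp add: rows_left_independent_def)
  then show ?thesis
    unfolding row_left_rank_def using assms by (subst Max_le_iff) auto
qed

text \<open>All lower bounds on the rank come from here: the rows outside a forcing set are
  independent.\<close>

lemma row_left_rank_ge_if_forcing:
  assumes "finite V" "Z \<subseteq> V" "forces V A Z V"
  shows "card V \<le> row_left_rank V A + card Z"
proof -
  have "rows_left_independent V A (V - Z)"
    using assms by (simp add: rows_left_independent_Diff_iff)
  then have "card (V - Z) \<le> row_left_rank V A"
    using assms(1) by (intro card_le_row_left_rank) auto
  then show ?thesis
    using assms(1,2) by (simp add: card_Diff_subset finite_subset)
qed

section \<open>Cyclic indexing of lists\<close>

lemma add_mod_cancel_left:
  fixes i j m t :: nat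
  shows "(t + i) mod m = (t + j) mod m \<longleftrightarrow> i mod m = j mod m"
proof -
  have "int (t + i) mod int m = int (t + j) mod int m \<longleftrightarrow> int i mod int m = int j mod int m"
    by (simp add: mod_eq_dvd_iff)
  then show ?thesis by (simp only: zmod_int[symmetric] of_nat_eq_iff)
qed

lemma minus_one_power_commute: "(- 1) ^ k * a = a * (- 1 :: 'b::ring_1) ^ k"
  by (cases "even k") simp_all

text \<open>Periodic extension of the list, so that going round a cycle needs no case for the
  wrap-around.\<close>

definition cyc :: "'a list \<Rightarrow> nat \<Rightarrow> 'a" where
  "cyc us i = us ! (i mod length us)"

lemma cyc_eq_iff:
  assumes "distinct us" "us \<noteq> []"
  shows "cyc us i = cyc us j \<longleftrightarrow> i mod length us = j mod length us"
  using assms by (simp add: cyc_def nth_eq_iff_index_eq)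

lemma range_cyc: "us \<noteq> [] \<Longrightarrow> range (cyc us) = set us"
proof (intro equalityI subsetI)
  fix v assume "us \<noteq> []" "v \<in> set us"
  then obtain i where "i < length us" "v = us ! i" by (metis in_set_conv_nth)
  then have "v = cyc us i" by (simp add: cyc_def)
  then show "v \<in> range (cyc us)" by blast
qed (auto simp: cyc_def)

lemma zip_rotate1: "us \<noteq> [] \<Longrightarrow>
    zip us (rotate1 us) = map (\<lambda>i. (cyc us i, cyc us (Suc i))) [0..<length us]"
  by (rule nth_equalityI) (simp_all add: cyc_def nth_rotate1)

lemma set_zip_rotate1:
  assumes "us \<noteq> []"
  shows "set (zip us (rotate1 us)) = range (\<lambda>i. (cyc us i, cyc us (Suc i)))"
proof -
  let ?e = "\<lambda>i. (cyc us i, cyc us (Suc i))"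
  have "?e i \<in> ?e ` {..<length us}" for i
  proof (rule image_eqI)
    show "?e i = ?e (i mod length us)" by (simp add: cyc_def mod_Suc_eq)
  qed (use assms in simp)
  then have "range ?e = ?e ` {..<length us}" by blast
  then show ?thesis by (simp add: zip_rotate1[OF assms] atLeast0LessThan)
qed

section \<open>Neighbourhoods and kernel vectors\<close>

context quaternion_gain_graph
begin

definition nbrs :: "'a \<Rightarrow> 'a set" where
  "nbrs v = {w. (v, w) \<in> parcs G}"

abbreviation gain_kernel :: "('a \<Rightarrow> quaternion) set" where
  "gain_kernel \<equiv> left_kernel (pverts G) (gain_adjacency G \<phi>)"

abbreviation gain_forces :: "'a set \<Rightarrow> 'a set \<Rightarrow> bool" where
  "gain_forces \<equiv> forces (pverts G) (gain_adjacency G \<phi>)"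

lemma nbrs_sym: "w \<in> nbrs v \<longleftrightarrow> v \<in> nbrs w"
  using arcs_symmetric by (auto simp: nbrs_def)

lemma nbrs_subset: "nbrs v \<subseteq> pverts G"
  by (auto simp: nbrs_def dest: in_arcsD2)

lemma finite_nbrs [simp]: "finite (nbrs v)"
  using nbrs_subset pair_finite_verts by (rule finite_subset)

lemma self_notin_nbrs: "v \<notin> nbrs v"
  using pair_no_loops[of "(v, v)"] by (auto simp: nbrs_def)

lemma gain_nonzero: "w \<in> nbrs v \<Longrightarrow> \<phi> (v, w) \<noteq> 0"
  using norm_gain[of v w] by (auto simp: nbrs_def)

lemma gain_mult_gain: "w \<in> nbrs v \<Longrightarrow> \<phi> (v, w) * \<phi> (w, v) = 1"
  using gain_inverse[of v w] gain_nonzero[of v w] nbrs_sym[of v w] gain_nonzero[of w v]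
  by (auto simp: nbrs_def)

lemma out_degree_eq_card_nbrs: "out_degree (with_proj G) v = card (nbrs v)"
proof -
  have "out_arcs (with_proj G) v = Pair v ` nbrs v"
    by (auto simp: out_arcs_def nbrs_def)
  then show ?thesis
    by (simp add: out_degree_def card_image inj_on_def)
qed

lemma mem_gain_kernel_iff:
  "x \<in> gain_kernel \<longleftrightarrow> (\<forall>v\<in>pverts G. (\<Sum>w\<in>nbrs v. x w * \<phi> (w, v)) = 0)"
proof -
  have "(\<Sum>w\<in>pverts G. x w * gain_adjacency G \<phi> w v) = (\<Sum>w\<in>nbrs v. x w * \<phi> (w, v))" for v
    using pair_finite_verts nbrs_subset arcs_symmetric
    by (intro sum.mono_neutral_cong_right) (auto simp: gain_adjacency_def nbrs_def)
  then show ?thesis by (simp add: left_kernel_def)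
qed

text \<open>The equation at \<open>v\<close> keeps a single term, \<open>x w\<close> times a nonzero
  gain.\<close>

lemma gain_kernel_last_nbr:
  assumes "x \<in> gain_kernel" "w \<in> nbrs v" "\<And>u. u \<in> nbrs v - {w} \<Longrightarrow> x u = 0"
  shows "x w = 0"
proof -
  have "v \<in> pverts G" using assms(2) nbrs_sym nbrs_subset by blast
  then have "(\<Sum>w\<in>nbrs v. x w * \<phi> (w, v)) = 0"
    using assms(1) by (simp add: mem_gain_kernel_iff)
  moreover have "(\<Sum>w\<in>nbrs v. x w * \<phi> (w, v)) = x w * \<phi> (w, v)"
    using assms(2,3) by (subst sum.remove[of _ w]) auto
  ultimately show ?thesis
    using assms(2) gain_nonzero nbrs_sym by simp
qed

text \<open>Handshake lemma: arcs are counted by their tails, and in pairs over the undirected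
  edges.\<close>

lemma sum_card_nbrs: "(\<Sum>v\<in>pverts G. card (nbrs v)) = 2 * card (undirected_edges G)"
proof -
  let ?f = "\<lambda>(u, v). {u, v}"
  have fin: "finite (parcs G)" by (rule pair_finite_arcs)
  have E: "undirected_edges G = ?f ` parcs G"
    by (auto simp: undirected_edges_def)
  have fibre: "card {a \<in> parcs G. ?f a = e} = 2" if "e \<in> undirected_edges G" for e
  proof -
    from that obtain u v where uv: "(u, v) \<in> parcs G" "e = {u, v}"
      by (auto simp: undirected_edges_def)
    then have "{a \<in> parcs G. ?f a = e} = {(u, v), (v, u)}"
      using arcs_symmetric by (auto simp: doubleton_eq_iff)
    moreover have "u \<noteq> v" using pair_no_loops[OF uv(1)] by simp
    ultimately show ?thesis by simp
  qed
  have "parcs G = Sigma (pverts G) nbrs"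
    by (auto simp: nbrs_def dest: in_arcsD1)
  then have "(\<Sum>v\<in>pverts G. card (nbrs v)) = card (parcs G)"
    using pair_finite_verts by simp
  also have "\<dots> = (\<Sum>e\<in>?f ` parcs G. card {a \<in> parcs G. ?f a = e})"
    unfolding card_eq_sum by (rule sum.image_gen[OF fin])
  also have "\<dots> = 2 * card (undirected_edges G)"
    using fibre by (simp flip: E)
  finally show ?thesis .
qed

end

section \<open>Connected gain graphs without pendant vertices\<close>

locale core_gain_graph = quaternion_gain_graph +
  assumes conn: "Digraph_Component.connected (with_proj G)"
    and two_le_degree: "v \<in> pverts G \<Longrightarrow> 2 \<le> card (nbrs v)"
begin

section \<open>Connectivity and the degree count\<close>

lemma strongly_conn: "strongly_connected (with_proj G)"
  using symmetric_connected_imp_strongly_connected pair_sym_arcs conn by blast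

lemma verts_nonempty: "pverts G \<noteq> {}"
  using strongly_conn by (simp add: strongly_connected_def)

text \<open>Membership propagates along paths, and connectivity provides a path from
  \<open>u\<close> to every vertex.\<close>

lemma nbr_closed_eq_verts:
  assumes "u \<in> K" "K \<subseteq> pverts G" "\<And>v. v \<in> K \<Longrightarrow> nbrs v \<subseteq> K"
  shows "K = pverts G"
proof
  show "pverts G \<subseteq> K"
  proof
    fix w assume "w \<in> pverts G"
    then have "u \<rightarrow>\<^sup>*\<^bsub>with_proj G\<^esub> w"
      using strongly_conn assms(1,2) by (auto simp: strongly_connected_def)
    then show "w \<in> K"
      by (induction rule: reachable_induct) (use assms in \<open>auto simp: nbrs_def\<close>)
  qed
qed (rule assms)

lemma card_sccs: "card (pre_digraph.sccs (with_proj G)) = 1"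
proof -
  have "sccs_verts = {pverts G}"
  proof (intro equalityI subsetI)
    fix S assume S: "S \<in> sccs_verts"
    then have "S \<subseteq> pverts G" "S \<noteq> {}"
      using sccs_verts_subsets[OF S] by (auto simp: in_sccs_verts_conv_reachable)
    then show "S \<in> {pverts G}"
      using S strongly_conn unfolding in_sccs_verts_conv_reachable strongly_connected_def
      by simp (metis subset_antisym subsetI ex_in_conv subsetD)
  next
    fix S assume "S \<in> {pverts G}"
    then show "S \<in> sccs_verts"
      using verts_nonempty strongly_conn
      unfolding in_sccs_verts_conv_reachable strongly_connected_def
      by (auto dest: reachable_in_verts)
  qed
  then show ?thesis by (simp flip: card_sccs_verts)
qed

text \<open>Handshake with a single component. Minimum degree 2 makes the truncated subtraction
  exact; with the initial slack 2 the total budget is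
  \<open>2 * cyclomatic_number G\<close>.\<close>

lemma sum_excess_degree:
  "int (\<Sum>v\<in>pverts G. card (nbrs v) - 2) = 2 * cyclomatic_number G - 2"
proof -
  define s where "s = (\<Sum>v\<in>pverts G. card (nbrs v) - 2)"
  have "s + 2 * card (pverts G) = (\<Sum>v\<in>pverts G. (card (nbrs v) - 2) + 2)"
    unfolding s_def by (simp only: sum.distrib sum_constant mult.commute of_nat_id)
  also have "\<dots> = (\<Sum>v\<in>pverts G. card (nbrs v))"
    by (rule sum.cong[OF refl le_add_diff_inverse2[OF two_le_degree]])
  finally have "s + 2 * card (pverts G) = 2 * card (undirected_edges G)"
    by (simp only: sum_card_nbrs)
  then show ?thesis
    unfolding s_def[symmetric] cyclomatic_number_def card_sccs by simp
qed

section \<open>Growing forcing sets\<close>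

text \<open>
  \<open>P\<close> are the processed vertices, \<open>K\<close> the known ones (those where a kernel vector vanishing on
  the chosen set \<open>Z\<close> must vanish).  Processing a known vertex with a known neighbour makes all
  its neighbours known; one of the unknown ones is forced by the kernel equation, so it costs at
  most \<open>deg - 2\<close> new choices.  The slack \<open>s\<close> is \<open>2\<close> for an edge as starting point, and a vertex of
  degree at least \<open>3\<close> processed with two known neighbours lowers it to \<open>1\<close>.
\<close>

definition exploration :: "nat \<Rightarrow> 'a set \<Rightarrow> 'a set \<Rightarrow> 'a set \<Rightarrow> bool" where
  "exploration s P K Z \<longleftrightarrow>
     P \<subseteq> K \<and> K \<subseteq> pverts G \<and> Z \<subseteq> pverts G \<and>
     (\<forall>v\<in>P. nbrs v \<subseteq> K) \<and> (\<forall>v\<in>K. nbrs v \<inter> K \<noteq> {}) \<and>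
     gain_forces Z K \<and>
     card Z \<le> s + (\<Sum>v\<in>P. card (nbrs v) - 2)"

text \<open>\<open>cost\<close> trades the slack \<open>s\<close> for \<open>s'\<close>. The
  \<open>- 1\<close> on its left is the neighbour forced by the equation at \<open>v\<close>;
  truncation gives 0 when nothing is unknown.\<close>

lemma exploration_step:
  assumes ex: "exploration s P K Z" and v: "v \<in> K" "v \<notin> P"
    and cost: "s + (card (nbrs v - K) - 1) \<le> s' + (card (nbrs v) - 2)"
  shows "\<exists>Z'. exploration s' (insert v P) (K \<union> nbrs v) Z'"
proof -
  have finP: "finite P"
    using ex pair_finite_verts unfolding exploration_def by (meson finite_subset)
  obtain B where B: "B \<subseteq> nbrs v - K" "card B \<le> card (nbrs v - K) - 1"
    and force: "gain_forces (K \<union> B) (nbrs v)"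
  proof (cases "nbrs v \<subseteq> K")
    case True
    then show ?thesis using that[of "{}"] by (auto simp: forces_def)
  next
    case False
    then obtain w where w: "w \<in> nbrs v - K" by blast
    \<comment> \<open>All unknown neighbours but \<open>w\<close> are chosen.\<close>
    show ?thesis
    proof (rule that[of "nbrs v - K - {w}"])
      show "gain_forces (K \<union> (nbrs v - K - {w})) (nbrs v)"
      proof (rule forcesI)
        fix x i assume x: "x \<in> gain_kernel" "\<And>i. i \<in> K \<union> (nbrs v - K - {w}) \<Longrightarrow> x i = 0"
          and i: "i \<in> nbrs v"
        have "x w = 0"
          using w x by (intro gain_kernel_last_nbr[of x w v]) auto
        with x(2)[of i] i show "x i = 0" by (cases "i = w") auto
      qed
    qed (use w in auto)
  qed
  have "card (Z \<union> B) \<le> card Z + card B" by (rule card_Un_le)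
  also have "\<dots> \<le> s' + (\<Sum>u\<in>insert v P. card (nbrs u) - 2)"
    using ex B(2) cost finP v(2) by (simp add: exploration_def)
  finally have card: "card (Z \<union> B) \<le> s' + (\<Sum>u\<in>insert v P. card (nbrs u) - 2)" .
  have zero: "gain_forces (Z \<union> B) (K \<union> nbrs v)"
  proof (rule forcesI)
    fix x i assume x: "x \<in> gain_kernel" "\<And>i. i \<in> Z \<union> B \<Longrightarrow> x i = 0" and i: "i \<in> K \<union> nbrs v"
    have "gain_forces Z K" using ex by (simp add: exploration_def)
    then have K: "x i = 0" if "i \<in> K" for i
      by (rule forcesD[OF _ x(1) _ that]) (simp add: x(2))
    have "x i = 0" if "i \<in> nbrs v" for i
      by (rule forcesD[OF force x(1) _ that]) (use K x(2) in auto)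
    with K i show "x i = 0" by blast
  qed
  \<comment> \<open>Newly known vertices have the known neighbour \<open>v\<close>.\<close>
  have "nbrs w \<inter> (K \<union> nbrs v) \<noteq> {}" if "w \<in> K \<union> nbrs v" for w
    using ex v(1) nbrs_sym[of w v] that unfolding exploration_def by blast
  moreover have "nbrs w \<subseteq> K \<union> nbrs v" if "w \<in> insert v P" for w
    using ex that unfolding exploration_def by blast
  moreover have "insert v P \<subseteq> K \<union> nbrs v" "K \<union> nbrs v \<subseteq> pverts G" "Z \<union> B \<subseteq> pverts G"
    using ex v(1) B(1) nbrs_subset[of v] unfolding exploration_def by blast+
  ultimately have "exploration s' (insert v P) (K \<union> nbrs v) (Z \<union> B)"
    using card zero unfolding exploration_def by blast
  then show ?thesis ..
qed

text \<open>\<open>F\<close> holds vertices whose processing is postponed. Any other known vertex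
  has a known neighbour, so it is processed without raising the slack; the unprocessed vertices run
  out.\<close>

lemma exploration_complete:
  assumes "exploration s P K Z"
  shows "\<exists>P' K' Z'. exploration s P' K' Z' \<and> K \<subseteq> K' \<and> P' \<inter> F = P \<inter> F \<and> K' - F \<subseteq> P'"
  using assms
proof (induction "card (pverts G - P)" arbitrary: P K Z rule: less_induct)
  case less
  show ?case
  proof (cases "K - F \<subseteq> P")
    case True
    then show ?thesis using less.prems by blast
  next
    case False
    then obtain v where v: "v \<in> K" "v \<notin> F" "v \<notin> P" by blast
    have "nbrs v - K \<subset> nbrs v"
      using less.prems v(1) by (auto simp: exploration_def)
    then have "card (nbrs v - K) < card (nbrs v)"
      by (simp add: psubset_card_mono)
    then have "s + (card (nbrs v - K) - 1) \<le> s + (card (nbrs v) - 2)"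
      by linarith
    from exploration_step[OF less.prems v(1,3) this]
    obtain Z' where Z': "exploration s (insert v P) (K \<union> nbrs v) Z'" ..
    have "v \<in> pverts G" using less.prems v(1) by (auto simp: exploration_def)
    then have "card (pverts G - insert v P) < card (pverts G - P)"
      using v(3) pair_finite_verts by (intro psubset_card_mono) auto
    from less.hyps[OF this Z'] obtain P' K' Z''
      where "exploration s P' K' Z''" "K \<union> nbrs v \<subseteq> K'" "P' \<inter> F = insert v P \<inter> F" "K' - F \<subseteq> P'"
      by (elim exE conjE)
    with v(2) show ?thesis
      by (intro exI[of _ P'] exI[of _ K'] exI[of _ Z'']) simp
  qed
qed

text \<open>\<open>w\<close> is the rest of a cycle through \<open>u\<close>. Saving one choice at
  \<open>u\<close> leaves a forcing set of at most \<open>2 * cyclomatic_number G - 1\<close>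
  vertices.\<close>

lemma rank_gt_if_branch_on_cycle:
  assumes u: "3 \<le> card (nbrs u)"
    and w: "\<And>i. i < k \<Longrightarrow> (w i, w (Suc i)) \<in> parcs G" "\<And>i. i \<le> k \<Longrightarrow> w i \<noteq> u"
    and ends: "w 0 \<in> nbrs u" "w k \<in> nbrs u" "w 0 \<noteq> w k"
  shows "int (card (pverts G)) - 2 * cyclomatic_number G < int (gain_rank G \<phi>)"
proof -
  have "u \<in> pverts G" and "w 0 \<in> pverts G"
    using ends(1) nbrs_subset nbrs_sym by blast+
  moreover have "card {u, w 0} \<le> 2" by (simp add: card_insert_if)
  ultimately have "exploration 2 {} {u, w 0} {u, w 0}"
    using ends(1) nbrs_sym by (auto simp: exploration_def forces_def)
  \<comment> \<open>The branch vertex \<open>u\<close> is processed only after the path has reached its second neighbour.\<close>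
  from exploration_complete[OF this, of "{u}"] obtain P K Z
    where ex: "exploration 2 P K Z" and K: "{u, w 0} \<subseteq> K" "K - {u} \<subseteq> P" and P: "u \<notin> P"
    by blast
  \<comment> \<open>Each \<open>w i\<close> differs from the postponed \<open>u\<close>, so it is
    processed and makes \<open>w (Suc i)\<close> known.\<close>
  have "i \<le> k \<Longrightarrow> w i \<in> K" for i
  proof (induction i)
    case (Suc i)
    then have "w i \<in> P" using K w(2)[of i] by auto
    then show ?case using ex w(1)[of i] Suc.prems by (auto simp: exploration_def nbrs_def)
  qed (use K in auto)
  then have "{w 0, w k} \<subseteq> nbrs u \<inter> K" using ends by auto
  then have "card {w 0, w k} \<le> card (nbrs u \<inter> K)" by (intro card_mono) auto
  moreover have "card (nbrs u) = card (nbrs u \<inter> K) + card (nbrs u - K)"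
    by (simp flip: card_Un_disjoint[of "nbrs u \<inter> K"] add: Int_Diff_Un Int_Diff_disjoint)
  \<comment> \<open>At most degree minus 2 neighbours are unknown; degree at least 3 keeps
    truncation from swallowing the saved choice.\<close>
  ultimately have "2 + (card (nbrs u - K) - 1) \<le> 1 + (card (nbrs u) - 2)"
    using u ends(3) by simp
  with exploration_step[OF ex _ P] K(1) obtain Z1
    where "exploration 1 (insert u P) (K \<union> nbrs u) Z1" by blast
  \<comment> \<open>With nothing postponed, the known set becomes closed under adjacency.\<close>
  from exploration_complete[OF this, of "{}"] obtain P2 K2 Z2
    where ex2: "exploration 1 P2 K2 Z2" and K2: "K \<union> nbrs u \<subseteq> K2" "K2 \<subseteq> P2"
    by auto
  have "K2 = pverts G"
    using ex2 K2 K(1) by (intro nbr_closed_eq_verts[of u]) (auto simp: exploration_def)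
  moreover have "P2 = K2" using ex2 K2 by (auto simp: exploration_def)
  ultimately have "Z2 \<subseteq> pverts G"
    and cZ: "card Z2 \<le> 1 + (\<Sum>v\<in>pverts G. card (nbrs v) - 2)"
    and "gain_forces Z2 (pverts G)"
    using ex2 by (auto simp: exploration_def)
  then have "card (pverts G) \<le> gain_rank G \<phi> + card Z2"
    unfolding gain_rank_def using pair_finite_verts by (intro row_left_rank_ge_if_forcing)
  then show ?thesis using cZ sum_excess_degree by linarith
qed

section \<open>Existence of a cycle\<close>

text \<open>A longest path closes up at a neighbour of its first vertex other than the second one;
  the initial segment up to it is the cycle.\<close>

lemma cycle_exists:
  obtains us where "3 \<le> length us" "distinct us" "set us \<subseteq> pverts G"
    "\<And>i. i < length us \<Longrightarrow> (us ! i, us ! (Suc i mod length us)) \<in> parcs G"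
proof -
  let ?path = "\<lambda>vs. vs \<noteq> [] \<and> distinct vs \<and> set vs \<subseteq> pverts G \<and>
    (\<forall>i. Suc i < length vs \<longrightarrow> (vs ! i, vs ! Suc i) \<in> parcs G)"
  obtain r where "r \<in> pverts G" using verts_nonempty by blast
  then have "?path [r]" by simp
  moreover have "length vs < Suc (card (pverts G))" if "?path vs" for vs
    using that pair_finite_verts by (metis card_mono distinct_card le_imp_less_Suc)
  \<comment> \<open>All neighbours of the first vertex of a longest path lie on the path.\<close>
  ultimately obtain vs where vs: "?path vs" and max: "\<And>ws. ?path ws \<Longrightarrow> length ws \<le> length vs"
    using ex_has_greatest_nat[of ?path "[r]" length "Suc (card (pverts G))"] by blast
  have nbrs_vs: "w \<in> set vs" if w: "w \<in> nbrs (vs ! 0)" for w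
  proof (rule ccontr)
    assume "w \<notin> set vs"
    moreover have "(w, vs ! 0) \<in> parcs G" "w \<in> pverts G"
      using w nbrs_sym nbrs_subset by (auto simp: nbrs_def)
    ultimately have "?path (w # vs)"
      using vs by (auto simp: nth_Cons split: nat.split)
    from max[OF this] show False by simp
  qed
  have "vs ! 0 \<in> pverts G" using vs by auto
  \<comment> \<open>For a one-vertex path \<open>vs ! 1\<close> is unspecified; the neighbour
    \<open>w\<close> found below could then only be \<open>vs ! 0\<close> itself, which has no
    loop.\<close>
  then have "\<not> nbrs (vs ! 0) \<subseteq> {vs ! 1}"
    using two_le_degree card_mono[of "{vs ! 1}" "nbrs (vs ! 0)"] by fastforce
  then obtain w where w: "w \<in> nbrs (vs ! 0)" "w \<noteq> vs ! 1" by blast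
  with nbrs_vs obtain j where j: "j < length vs" "w = vs ! j" by (metis in_set_conv_nth)
  with w have "j \<noteq> 0" "j \<noteq> 1" using self_notin_nbrs by metis+
  show ?thesis
  proof (rule that[of "take (Suc j) vs"])
    show "3 \<le> length (take (Suc j) vs)" using j \<open>j \<noteq> 0\<close> \<open>j \<noteq> 1\<close> by simp
    show "distinct (take (Suc j) vs)" using vs by simp
    show "set (take (Suc j) vs) \<subseteq> pverts G" using vs set_take_subset by fast
    have len: "length (take (Suc j) vs) = Suc j" using j by simp
    fix i assume "i < length (take (Suc j) vs)"
    then consider "i < j" | "i = j" using j by fastforce
    then show "(take (Suc j) vs ! i, take (Suc j) vs ! (Suc i mod length (take (Suc j) vs)))
        \<in> parcs G"
    proof cases
      case 1
      then show ?thesis using vs j by (simp add: len del: length_take)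
    next
      case 2
      then show ?thesis using w(1) j nbrs_sym[of "vs ! 0" w]
        by (simp add: len nbrs_def del: length_take)
    qed
  qed
qed

end

section \<open>Gain cycles\<close>

text \<open>\<open>f\<close> runs round the cycle periodically; \<open>nbrs_f\<close> is stated at
  successors to avoid a predecessor of 0.\<close>

locale gain_cycle = quaternion_gain_graph +
  fixes m :: nat and f :: "nat \<Rightarrow> 'a"
  assumes three_le: "3 \<le> m"
    and f_eq_iff: "f i = f j \<longleftrightarrow> i mod m = j mod m"
    and range_f: "range f = pverts G"
    and nbrs_f: "nbrs (f (Suc i)) = {f i, f (Suc (Suc i))}"
begin

lemma f_add_m [simp]: "f (i + m) = f i" "f (m + i) = f i"
  by (simp_all add: f_eq_iff)

lemma f_neq_f2: "f i \<noteq> f (Suc (Suc i))"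
  using add_mod_cancel_left[of i 0 m 2] three_le by (simp add: f_eq_iff)

lemma card_verts: "card (pverts G) = m"
proof -
  have "pverts G = f ` {..<m}"
  proof -
    have "f i = f (i mod m)" "i mod m < m" for i
      using three_le by (simp_all add: f_eq_iff)
    then have "range f \<subseteq> f ` {..<m}" by blast
    then show ?thesis using range_f by blast
  qed
  moreover have "inj_on f {..<m}" by (auto simp: inj_on_def f_eq_iff)
  ultimately show ?thesis by (simp add: card_image)
qed

lemma card_nbrs_eq_2:
  assumes "v \<in> pverts G"
  shows "card (nbrs v) = 2"
proof -
  obtain j where "v = f j" using assms range_f by blast
  also have "f j = f (Suc (j + m - 1))" using three_le by simp
  finally show ?thesis by (simp add: nbrs_f f_neq_f2)
qed

lemma gain_cycle_shift: "gain_cycle G \<phi> m (\<lambda>i. f (t + i))"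
proof unfold_locales
  show "f (t + i) = f (t + j) \<longleftrightarrow> i mod m = j mod m" for i j
    by (simp add: f_eq_iff add_mod_cancel_left)
  show "range (\<lambda>i. f (t + i)) = pverts G"
  proof -
    \<comment> \<open>Adding \<open>t\<close> full turns makes the subtraction of \<open>t\<close>
      exact.\<close>
    have "f j = f (t + (j + t * m - t))" for j
    proof -
      have "t \<le> t * m" using three_le by (cases m) simp_all
      then have "t + (j + t * m - t) = j + t * m" by linarith
      then show ?thesis by (simp only: f_eq_iff mod_mult_self1)
    qed
    then have "f j \<in> range (\<lambda>i. f (t + i))" for j by (rule range_eqI)
    then have "range f \<subseteq> range (\<lambda>i. f (t + i))" by (rule image_subsetI)
    moreover have "range (\<lambda>i. f (t + i)) \<subseteq> range f" by (intro image_subsetI rangeI)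
    ultimately show ?thesis unfolding range_f by (intro subset_antisym)
  qed
qed (use three_le nbrs_f in simp_all)

section \<open>Gains along the cycle\<close>

definition walk_gain :: "nat \<Rightarrow> nat \<Rightarrow> quaternion" where
  "walk_gain i k = prod_list (map (\<lambda>l. \<phi> (f l, f (Suc l))) [i..<i + k])"

lemma walk_gain_0 [simp]: "walk_gain i 0 = 1"
  by (simp add: walk_gain_def)

lemma walk_gain_Suc: "walk_gain i (Suc k) = walk_gain i k * \<phi> (f (i + k), f (Suc (i + k)))"
  by (simp add: walk_gain_def)

lemma walk_gain_add: "walk_gain i (k + l) = walk_gain i k * walk_gain (i + k) l"
  by (induction l) (simp_all add: walk_gain_Suc mult.assoc add.assoc)

lemma walk_gain_period: "walk_gain (m + i) k = walk_gain i k"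
proof (induction k)
  case (Suc k)
  have "f (m + i + k) = f (i + k)" "f (Suc (m + i + k)) = f (Suc (i + k))"
    using f_add_m(2)[of "i + k"] f_add_m(2)[of "Suc (i + k)"] by (simp_all add: add.assoc)
  with Suc show ?case by (simp add: walk_gain_Suc)
qed simp

lemma f_step: "f (Suc i) \<in> nbrs (f i)"
  using nbrs_f[of i] nbrs_sym by blast

lemma walk_gain_shift: "gain_cycle.walk_gain \<phi> (\<lambda>i. f (t + i)) 0 k = walk_gain t k"
proof -
  interpret s: gain_cycle G \<phi> m "\<lambda>i. f (t + i)" by (rule gain_cycle_shift)
  show ?thesis by (induction k) (simp_all add: s.walk_gain_Suc walk_gain_Suc)
qed

lemma walk_gain_nonzero: "walk_gain i k \<noteq> 0"
  by (induction k) (simp_all add: walk_gain_Suc gain_nonzero f_step)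

section \<open>Kernel vectors of a gain cycle\<close>

text \<open>The equation at \<open>f (Suc i)\<close> has two terms, and reversed gains are inverse.
  The resulting recurrence jumps by two, so it links only indices of equal parity.\<close>

lemma mem_gain_kernel_cycle_iff:
  "x \<in> gain_kernel \<longleftrightarrow>
    (\<forall>i. x (f (Suc (Suc i))) =
      - (x (f i) * \<phi> (f i, f (Suc i)) * \<phi> (f (Suc i), f (Suc (Suc i)))))"
proof -
  have "(\<Sum>w\<in>nbrs (f (Suc i)). x w * \<phi> (w, f (Suc i))) = 0 \<longleftrightarrow>
      x (f (Suc (Suc i))) = - (x (f i) * \<phi> (f i, f (Suc i)) * \<phi> (f (Suc i), f (Suc (Suc i))))"
    (is "?s = 0 \<longleftrightarrow> ?b = - (?a * ?r)") for i
  proof -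
    let ?q = "\<phi> (f (Suc (Suc i)), f (Suc i))"
    have qr: "?q * ?r = 1" "?r * ?q = 1"
      using gain_mult_gain f_step nbrs_sym by blast+
    have "?s = ?a + ?b * ?q"
      by (simp add: nbrs_f f_neq_f2)
    also have "\<dots> = 0 \<longleftrightarrow> ?b * ?q = - ?a" by (simp add: add_eq_0_iff)
    also have "\<dots> \<longleftrightarrow> ?b = - (?a * ?r)"
    proof
      assume "?b * ?q = - ?a"
      then have "?b * ?q * ?r = - ?a * ?r" by simp
      then show "?b = - (?a * ?r)" using qr by (simp add: mult.assoc)
    next
      assume "?b = - (?a * ?r)"
      then show "?b * ?q = - ?a" using qr by (simp add: mult.assoc)
    qed
    finally show ?thesis .
  qed
  moreover have verts: "pverts G = range (\<lambda>i. f (Suc i))"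
  proof -
    interpret s: gain_cycle G \<phi> m "\<lambda>i. f (1 + i)" by (rule gain_cycle_shift)
    show ?thesis using s.range_f by simp
  qed
  ultimately show ?thesis
    by (subst mem_gain_kernel_iff) (simp only: verts ball_simps(9) ball_UNIV)
qed

lemma gain_kernel_iterate:
  assumes "x \<in> gain_kernel"
  shows "x (f (i + 2 * k)) = (- 1) ^ k * x (f i) * walk_gain i (2 * k)"
proof (induction k)
  case (Suc k)
  then show ?case
    using assms[unfolded mem_gain_kernel_cycle_iff, rule_format, of "i + 2 * k"]
    by (simp add: walk_gain_Suc mult.assoc)
qed simp

lemma gain_kernel_vector:
  assumes "even m" and gain: "walk_gain 0 m = (- 1) ^ (m div 2)"
  obtains x where "x \<in> gain_kernel" "x (f 0) = 1" "\<And>k. odd k \<Longrightarrow> x (f k) = 0"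
proof -
  \<comment> \<open>Solution of the recurrence with value 1 at index 0 and 0 at odd indices.\<close>
  define h where "h k = (if even k then (- 1) ^ (k div 2) * walk_gain 0 k else 0)" for k
  \<comment> \<open>One turn contributes a sign and the gain, both \<open>(- 1) ^ (m div 2)\<close>,
    which cancel.\<close>
  have period: "h (m + k) = h k" for k
  proof (cases "even k")
    case True
    then have "h (m + k) = (- 1) ^ (m div 2 + k div 2) * (walk_gain 0 m * walk_gain 0 k)"
      using \<open>even m\<close> walk_gain_period[of 0 k]
      by (simp add: h_def walk_gain_add div_plus_div_distrib_dvd_left)
    also have "\<dots> = (- 1) ^ (2 * (m div 2) + k div 2) * walk_gain 0 k"
      unfolding gain mult.assoc[symmetric] power_add[symmetric]
      by (simp only: mult_2 ac_simps)
    also have "\<dots> = h k" using True by (simp add: h_def power_add)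
    finally show ?thesis .
  qed (use \<open>even m\<close> in \<open>simp add: h_def\<close>)
  have "h (q * m + k) = h k" for q k
    by (induction q) (simp_all add: add.assoc period)
  then have h_mod: "h (k mod m) = h k" for k
    by (metis div_mult_mod_eq)
  \<comment> \<open>Periodicity makes the choice of index irrelevant.\<close>
  define x where "x v = h (SOME k. f k = v)" for v
  have x: "x (f k) = h k" for k
  proof -
    have "f (SOME j. f j = f k) = f k" by (rule someI[of _ k]) simp
    then have "(SOME j. f j = f k) mod m = k mod m" by (simp add: f_eq_iff)
    then show ?thesis unfolding x_def by (metis h_mod)
  qed
  have "x \<in> gain_kernel"
    unfolding mem_gain_kernel_cycle_iff by (simp add: x h_def walk_gain_Suc mult.assoc)
  then show ?thesis using that[of x] by (simp add: x h_def)
qed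

text \<open>Gains of full turns from different starting points are conjugate, and signs are
  central.\<close>

lemma walk_gain_rotate:
  assumes "walk_gain 0 m = (- 1) ^ k"
  shows "walk_gain t m = (- 1) ^ k"
proof -
  have "walk_gain 0 t * walk_gain t m = walk_gain 0 m * walk_gain m t"
    using walk_gain_add[of 0 t m] walk_gain_add[of 0 m t] by (simp add: add.commute)
  also have "\<dots> = walk_gain 0 t * (- 1) ^ k"
    using walk_gain_period[of 0 t] by (simp add: assms minus_one_power_commute)
  finally show ?thesis using walk_gain_nonzero by simp
qed

section \<open>The rank of a gain cycle\<close>

text \<open>Two adjacent vertices force all others, one per parity class; a single vertex never
  does, since some nonzero kernel vector vanishes there.\<close>

lemma rank_plus_2_if_type1:
  assumes "even m" and gain: "walk_gain 0 m = (- 1) ^ (m div 2)"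
  shows "gain_rank G \<phi> + 2 = m"
proof -
  have "gain_forces {f 0, f 1} (pverts G)"
  proof (rule forcesI)
    fix x v assume x: "x \<in> gain_kernel" "\<And>i. i \<in> {f 0, f 1} \<Longrightarrow> x i = 0" and "v \<in> pverts G"
    then obtain j where "v = f j" using range_f by blast
    moreover have "j = j mod 2 + 2 * (j div 2)" by simp
    ultimately have "v = f (j mod 2 + 2 * (j div 2))" by simp
    moreover have "x (f (j mod 2)) = 0" using x(2)
      by (cases "even j") (simp_all add: odd_iff_mod_2_eq_one even_iff_mod_2_eq_zero)
    ultimately show "x v = 0"
      using gain_kernel_iterate[OF x(1), of "j mod 2" "j div 2"] by simp
  qed
  then have "m \<le> gain_rank G \<phi> + card {f 0, f 1}"
    unfolding gain_rank_def card_verts[symmetric] using range_f pair_finite_verts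
    by (intro row_left_rank_ge_if_forcing) auto
  moreover have "card {f 0, f 1} \<le> 2" by (simp add: card_insert_if)
  moreover have "gain_rank G \<phi> \<le> m - 2"
    unfolding gain_rank_def
  proof (rule row_left_rank_leI)
    fix S assume S: "S \<subseteq> pverts G"
      "rows_left_independent (pverts G) (gain_adjacency G \<phi>) S"
    define Z where "Z = pverts G - S"
    have SZ: "pverts G - Z = S" using S(1) by (auto simp: Z_def)
    with S(2) have forces: "gain_forces Z (pverts G)"
      using rows_left_independent_Diff_iff[OF pair_finite_verts, of "gain_adjacency G \<phi>" Z] by simp
    show "card S \<le> m - 2"
    proof (rule ccontr)
      assume "\<not> card S \<le> m - 2"
      then have "card Z \<le> 1"
        using S(1) pair_finite_verts unfolding Z_def card_verts[symmetric]
        by (simp add: card_Diff_subset finite_subset)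
      moreover have "finite Z" using pair_finite_verts by (simp add: Z_def)
      ultimately have "\<forall>a\<in>Z. \<forall>b\<in>Z. a = b" by (simp add: card_le_Suc0_iff_eq)
      moreover have "Z \<subseteq> range f" using range_f by (auto simp: Z_def)
      ultimately obtain t where t: "Z \<subseteq> {f t}" by (cases "Z = {}") blast+
      \<comment> \<open>Started at the next vertex, the kernel vector vanishes at
        \<open>f t\<close>, which lies at the odd distance \<open>m - 1\<close>.\<close>
      interpret s: gain_cycle G \<phi> m "\<lambda>i. f (Suc t + i)" by (rule gain_cycle_shift)
      have "s.walk_gain 0 m = walk_gain (Suc t) m"
        by (rule walk_gain_shift)
      then have "s.walk_gain 0 m = (- 1) ^ (m div 2)"
        using walk_gain_rotate[OF gain] by simp
      from s.gain_kernel_vector[OF \<open>even m\<close> this] obtain y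
        where y: "y \<in> gain_kernel" "y (f (Suc t)) = 1" "\<And>k. odd k \<Longrightarrow> y (f (Suc t + k)) = 0"
        by auto
      have "Suc t + (m - 1) = t + m" "odd (m - 1)" using three_le \<open>even m\<close> by auto
      then have "y (f t) = 0" using y(3)[of "m - 1"] by simp
      then have "y i = 0" if "i \<in> Z" for i using t that by blast
      from forcesD[OF forces y(1) this, of "f (Suc t)"] y(2) range_f show False by auto
    qed
  qed (rule pair_finite_verts)
  ultimately show ?thesis using three_le by linarith
qed

text \<open>One vertex forces all. For odd \<open>m\<close>, steps of two reach everything; for even
  \<open>m\<close>, a full turn multiplies \<open>x (f 0)\<close> by a factor other than 1.\<close>

lemma rank_ge_if_not_type1:
  assumes "\<not> (even m \<and> walk_gain 0 m = (- 1) ^ (m div 2))"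
  shows "m \<le> gain_rank G \<phi> + 1"
proof -
  \<comment> \<open>For even \<open>m\<close> the chosen \<open>f 1\<close> settles the odd class,
    leaving the class of \<open>f 0\<close> to the gain condition.\<close>
  let ?r = "if even m then 1 else 0 :: nat"
  have "gain_forces {f ?r} (pverts G)"
  proof (rule forcesI)
    fix x v assume x: "x \<in> gain_kernel" "\<And>i. i \<in> {f ?r} \<Longrightarrow> x i = 0" and "v \<in> pverts G"
    then obtain j where j: "v = f j" using range_f by blast
    note it = gain_kernel_iterate[OF x(1)]
    show "x v = 0"
    proof (cases "even m")
      case False
      obtain k where "j = 2 * k \<or> j + m = 2 * k"
        using False by (metis dvdE even_add)
      then have "f j = f (0 + 2 * k)" by (metis add_0 f_add_m(1))
      then show ?thesis using it[of 0 k] x(2) False j by simp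
    next
      case True
      have 1: "x (f 1) = 0" using x(2) True by simp
      have "x (f 0) = (- 1) ^ (m div 2) * x (f 0) * walk_gain 0 m"
        using it[of 0 "m div 2"] f_add_m(2)[of 0] True by simp
      also have "\<dots> = x (f 0) * ((- 1) ^ (m div 2) * walk_gain 0 m)"
        by (simp add: minus_one_power_commute mult.assoc)
      finally have "x (f 0) = 0 \<or> (- 1) ^ (m div 2) * walk_gain 0 m = 1" by simp
      moreover have "(- 1) ^ (m div 2) * walk_gain 0 m \<noteq> 1"
      proof
        assume "(- 1) ^ (m div 2) * walk_gain 0 m = 1"
        \<comment> \<open>Multiplying by the sign, its own inverse, would give the excluded
          gain.\<close>
        then have "(- 1) ^ (m div 2) * ((- 1) ^ (m div 2) * walk_gain 0 m) = (- 1) ^ (m div 2)"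
          by simp
        then show False using assms True
          by (simp add: mult.assoc[symmetric] power_add[symmetric] flip: mult_2)
      qed
      ultimately have "x (f (j mod 2)) = 0"
        using 1 by (cases "even j") (simp_all add: odd_iff_mod_2_eq_one even_iff_mod_2_eq_zero)
      then show ?thesis using it[of "j mod 2" "j div 2"] j by simp
    qed
  qed
  then have "m \<le> gain_rank G \<phi> + card {f ?r}"
    unfolding gain_rank_def card_verts[symmetric] using range_f pair_finite_verts
    by (intro row_left_rank_ge_if_forcing) auto
  then show ?thesis by simp
qed

lemma rank_plus_2_iff:
  "gain_rank G \<phi> + 2 = m \<longleftrightarrow> even m \<and> walk_gain 0 m = (- 1) ^ (m div 2)"
  using rank_plus_2_if_type1 rank_ge_if_not_type1 by fastforce

end

context quaternion_gain_graph
begin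

lemma gain_cycle_cyc:
  assumes "cyclic_ordering G us"
  shows "gain_cycle G \<phi> (length us) (cyc us)"
proof unfold_locales
  have us: "3 \<le> length us" "distinct us" "set us = pverts G" "us \<noteq> []"
    using assms by (auto simp: cyclic_ordering_def)
  have arcs: "parcs G = range (\<lambda>i. (cyc us i, cyc us (Suc i))) \<union>
      (range (\<lambda>i. (cyc us i, cyc us (Suc i))))\<inverse>"
    using assms unfolding cyclic_ordering_def set_zip_rotate1[OF us(4)] by blast
  show "3 \<le> length us" by fact
  show eq: "cyc us i = cyc us j \<longleftrightarrow> i mod length us = j mod length us" for i j
    using us by (simp add: cyc_eq_iff)
  show "range (cyc us) = pverts G" using us by (simp add: range_cyc)
  fix i
  \<comment> \<open>Positions determine their successors and predecessors, so no arcs lead beyond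
    the two adjacent positions.\<close>
  have Suc: "cyc us (Suc k) = cyc us (Suc l) \<longleftrightarrow> cyc us k = cyc us l" for k l
    using add_mod_cancel_left[of 1 k "length us" l] by (simp add: eq)
  show "nbrs (cyc us (Suc i)) = {cyc us i, cyc us (Suc (Suc i))}"
    unfolding nbrs_def arcs by (auto simp: Suc)
qed

end

section \<open>The rank bound and its equality case\<close>

context core_gain_graph
begin

text \<open>All degrees are 2, so the excess vanishes and the cyclomatic number is 1. The left side
  does not mention \<open>us\<close>, so the gain condition holds for all cyclic orderings or for
  none.\<close>

lemma cyclic_ordering_rank_iff:
  assumes "cyclic_ordering G us"
  shows "int (gain_rank G \<phi>) = int (card (pverts G)) - 2 * cyclomatic_number G \<longleftrightarrow>
    even (length us) \<and> cycle_gain \<phi> us = (- 1) ^ (length us div 2)"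
proof -
  interpret c: gain_cycle G \<phi> "length us" "cyc us" using assms by (rule gain_cycle_cyc)
  have "us \<noteq> []" using c.three_le by auto
  then have "cycle_gain \<phi> us = c.walk_gain 0 (length us)"
    by (simp add: cycle_gain_def c.walk_gain_def zip_rotate1 comp_def)
  moreover have "cyclomatic_number G = 1"
    using sum_excess_degree c.card_nbrs_eq_2 by simp
  ultimately show ?thesis
    using c.rank_plus_2_iff c.card_verts by auto
qed

text \<open>Take any cycle. A vertex of degree at least 3 on it makes both sides false; otherwise no
  arc leaves it and it is all of \<open>G\<close>.\<close>

lemma rank_eq_iff_type1:
  "int (gain_rank G \<phi>) = int (card (pverts G)) - 2 * cyclomatic_number G \<longleftrightarrow>
    type1_gain_cycle G \<phi>"
proof -
  obtain us where us: "3 \<le> length us" "distinct us" "set us \<subseteq> pverts G"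
    and arc: "\<And>i. i < length us \<Longrightarrow> (us ! i, us ! (Suc i mod length us)) \<in> parcs G"
    using cycle_exists by blast
  let ?m = "length us"
  have "us \<noteq> []" using us(1) by auto
  have range: "range (cyc us) = set us" using \<open>us \<noteq> []\<close> by (rule range_cyc)
  have cyc_mem: "cyc us i \<in> set us" for i
    unfolding range[symmetric] by (rule rangeI)
  have step: "(cyc us i, cyc us (Suc i)) \<in> parcs G" for i
    using arc[of "i mod ?m"] \<open>us \<noteq> []\<close> by (simp add: cyc_def mod_Suc_eq)
  have eq: "cyc us (t + i) = cyc us (t + j) \<longleftrightarrow> i mod ?m = j mod ?m" for t i j
    using us(2) \<open>us \<noteq> []\<close> by (simp add: cyc_eq_iff add_mod_cancel_left)
  show ?thesis
  proof (cases "\<exists>u\<in>set us. 3 \<le> card (nbrs u)")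
    case True
    then obtain k where k: "3 \<le> card (nbrs (cyc us k))"
      unfolding range[symmetric] by blast
    have "cyc us (k + ?m) = cyc us k" by (simp add: cyc_def)
    moreover have "Suc (Suc k + (?m - 2)) = k + ?m" using us(1) by linarith
    ultimately have last: "(cyc us (Suc k + (?m - 2)), cyc us k) \<in> parcs G"
      using step[of "Suc k + (?m - 2)"] by (simp only:)
    \<comment> \<open>The walk lists the other \<open>?m - 1\<close> vertices of the cycle, at
      offsets 0 to \<open>?m - 2\<close> from \<open>Suc k\<close>.\<close>
    have "int (card (pverts G)) - 2 * cyclomatic_number G < int (gain_rank G \<phi>)"
    proof (rule rank_gt_if_branch_on_cycle[OF k, of "?m - 2" "\<lambda>i. cyc us (Suc k + i)"])
      show "cyc us (Suc k + i) \<noteq> cyc us k" if "i \<le> ?m - 2" for i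
        using eq[of k "Suc i" 0] that us(1) by simp
      show "cyc us (Suc k + 0) \<in> nbrs (cyc us k)"
        using step[of k] by (simp add: nbrs_def)
      show "cyc us (Suc k + (?m - 2)) \<in> nbrs (cyc us k)"
        using last nbrs_sym by (simp only: nbrs_def mem_Collect_eq)
      show "cyc us (Suc k + 0) \<noteq> cyc us (Suc k + (?m - 2))"
        using eq[of "Suc k" 0 "?m - 2"] us(1) by simp
    qed (use step in simp)
    moreover have "\<not> type1_gain_cycle G \<phi>"
    proof
      assume "type1_gain_cycle G \<phi>"
      then obtain ws where "cyclic_ordering G ws" by (auto simp: type1_gain_cycle_def)
      then interpret c: gain_cycle G \<phi> "length ws" "cyc ws" by (rule gain_cycle_cyc)
      show False using c.card_nbrs_eq_2[OF subsetD[OF us(3) cyc_mem], of k] k by simp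
    qed
    ultimately show ?thesis by simp
  next
    case False
    have nbrs: "nbrs (cyc us (Suc i)) = {cyc us i, cyc us (Suc (Suc i))}" for i
    proof (rule sym, rule card_subset_eq)
      show "{cyc us i, cyc us (Suc (Suc i))} \<subseteq> nbrs (cyc us (Suc i))"
        using step[of i] step[of "Suc i"] arcs_symmetric by (auto simp: nbrs_def)
      have "2 \<le> card (nbrs (cyc us (Suc i)))"
        using us(3) cyc_mem by (intro two_le_degree) (rule subsetD)
      moreover have "\<not> 3 \<le> card (nbrs (cyc us (Suc i)))"
        using False cyc_mem by blast
      moreover have "cyc us i \<noteq> cyc us (Suc (Suc i))"
        using eq[of i 0 2] us(1) by simp
      ultimately show "card {cyc us i, cyc us (Suc (Suc i))} = card (nbrs (cyc us (Suc i)))"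
        by simp
    qed simp
    have Suc_index: "\<exists>i. v = cyc us (Suc i)" if v: "v \<in> set us" for v
    proof -
      obtain j where "v = cyc us j" using v unfolding range[symmetric] by blast
      moreover have "Suc (j + ?m - 1) = j + ?m" using us(1) by linarith
      then have "cyc us j = cyc us (Suc (j + ?m - 1))" by (simp only: cyc_def mod_add_self2)
      ultimately show ?thesis by blast
    qed
    have "set us = pverts G"
    proof (rule nbr_closed_eq_verts)
      show "us ! 0 \<in> set us" using \<open>us \<noteq> []\<close> by simp
      show "nbrs v \<subseteq> set us" if "v \<in> set us" for v
        using Suc_index[OF that] nbrs cyc_mem by auto
    qed fact
    moreover have "parcs G \<subseteq> range (\<lambda>i. (cyc us i, cyc us (Suc i))) \<union>
      (range (\<lambda>i. (cyc us i, cyc us (Suc i))))\<inverse>"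
    proof
      fix e assume e: "e \<in> parcs G"
      obtain a b where ab: "e = (a, b)" by fastforce
      with e have "a \<in> set us" "b \<in> nbrs a"
        using \<open>set us = pverts G\<close> by (auto simp: nbrs_def dest: in_arcsD1)
      with Suc_index nbrs obtain i where "a = cyc us (Suc i)" "b \<in> {cyc us i, cyc us (Suc (Suc i))}"
        by metis
      then show "e \<in> range (\<lambda>i. (cyc us i, cyc us (Suc i))) \<union>
          (range (\<lambda>i. (cyc us i, cyc us (Suc i))))\<inverse>"
        using ab by auto
    qed
    ultimately have "cyclic_ordering G us"
      using us step arcs_symmetric set_zip_rotate1[OF \<open>us \<noteq> []\<close>]
      by (auto simp: cyclic_ordering_def)
    then show ?thesis
      unfolding type1_gain_cycle_def using cyclic_ordering_rank_iff by blast
  qed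
qed

end

theorem theorem4p1:
  fixes G :: "'a pair_pre_digraph"
    and \<phi> :: "'a \<times> 'a \<Rightarrow> quaternion"
    and n :: nat
  assumes "quaternion_gain_graph G \<phi>"
    and "Digraph_Component.connected (with_proj G)"
    and "card (pverts G) = n"
    and "n \<ge> 2"
    and "num_pendant G = 0"
  shows "int (gain_rank G \<phi>) = int n - 2 * cyclomatic_number G \<longleftrightarrow> type1_gain_cycle G \<phi>"
proof -
  interpret quaternion_gain_graph G \<phi> by fact
  interpret core_gain_graph G \<phi>
  proof unfold_locales
    fix v assume v: "v \<in> pverts G"
    have "card (nbrs v) \<noteq> 1"
      using assms(5) v pair_finite_verts by (auto simp: num_pendant_def out_degree_eq_card_nbrs)
    \<comment> \<open>As \<open>n\<close> is at least 2, a path from \<open>v\<close> to another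
      vertex starts with an arc at \<open>v\<close>.\<close>
    moreover have "nbrs v \<noteq> {}"
    proof -
      have "pverts G \<noteq> {v}" using assms(3,4) by auto
      then obtain u where u: "u \<in> pverts G" "u \<noteq> v" using v by blast
      have "strongly_connected (with_proj G)"
        using symmetric_connected_imp_strongly_connected pair_sym_arcs assms(2) by blast
      then have "v \<rightarrow>\<^sup>*\<^bsub>with_proj G\<^esub> u" using u v by (auto simp: strongly_connected_def)
      then show ?thesis
        using u(2) by (cases rule: converse_reachable_cases) (auto simp: nbrs_def)
    qed
    ultimately show "2 \<le> card (nbrs v)"
      by (metis One_nat_def card_0_eq finite_nbrs less_2_cases not_le)
  qed (rule assms(2))
  show ?thesis using rank_eq_iff_type1 assms(3) by simp
qed

end
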